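(* 1. Any composition of $t$-exact functors is $t$-exact. 2. Any composition of weight-exact functors is weight-exact. Let $\mathcal C$ and $\mathcal C'$ be triangulated categories endowed with $t$-structures $t$ and $t'$ and with weight structures $w$ and $w'$, respectively, and let $F:\mathcal C\to\mathcal C'$ and $G:\mathcal C'\to\mathcal C$ be exact functors. 3. Suppose that $(w,t)$ and $(w',t')$ are left adjacent and that $G$ is left adjoint to $F$. Then $G$ is weight-exact if and only if $F$ is $t$-exact. 4. Suppose that $(w,t)$ and $(w',t')$ are right adjacent and that $G$ is right adjoint to $F$. Then $G$ is weight-exact if and only if $F$ is $t$-exact.
   Context: $D\perp E$ means $\mathcal C(X,Y)=0$ for all $X\in D$, $Y\in E$. A weight structure $w$ on a triangulated category $\mathcal C$ is a pair of subclasses $\mathcal C^{w\le 0},\mathcal C^{w\ge 0}\subset\mathrm{Obj}\,\mathcal C$ such that: (i) both are additive and Karoubi-closed in $\mathcal C$ (contain all retracts of their objects); (ii) $\mathcal C^{w\ge 0}\subset \mathcal C^{w\ge 0}[1]$ and $\mathcal C^{w\le 0}[1]\subset \mathcal C^{w\le 0}$; (iii) $\mathcal C^{w\ge 0}\perp\mathcal C^{w\le 0}[1]$; (iv) for every $X$ there is a distinguished triangle $B[-1]\to X\to A\to B$ with $A\in\mathcal C^{w\le 0}$, $B\in\mathcal C^{w\ge 0}$. $t$-structures are in cohomological notation: classes $\mathcal C^{t\le0},\mathcal C^{t\ge0}$ closed under isomorphism with $\mathcal C^{t\ge0}\subset\mathcal C^{t\ge0}[1]$, $\mathcal C^{t\le0}[1]\subset\mathcal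 C^{t\le0}$, $\mathcal C^{t\le0}[1]\perp\mathcal C^{t\ge0}$, and every $X$ has a distinguished triangle $A\to X\to B\to A[1]$ with $A\in\mathcal C^{t\le0}$, $B\in\mathcal C^{t\ge0}[-1]$. The pair $(w,t)$ is left adjacent if $\mathcal C^{w\le0}=\mathcal C^{t\le0}$, and right adjacent if $\mathcal C^{w\ge0}=\mathcal C^{t\ge0}$. An exact functor $F:\mathcal C\to\mathcal C'$ is $t$-exact (with respect to $t,t'$) if $F(\mathcal C^{t\le0})\subset\mathcal C'^{t'\le0}$ and $F(\mathcal C^{t\ge0})\subset\mathcal C'^{t'\ge0}$; it is weight-exact (with respect to $w,w'$) if $F(\mathcal C^{w\le0})\subset\mathcal C'^{w'\le0}$ and $F(\mathcal C^{w\ge0})\subset\mathcal C'^{w'\ge0}$ (and similarly for functors in the other direction). "Exact functor" means a functor of triangulated categories. *)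

theory Defs
  imports "HOL-Algebra.Group"
begin

record ('o, 'm) precat =
  objs :: "'o set"
  arrs :: "'m set"
  src :: "'m \<Rightarrow> 'o"
  tgt :: "'m \<Rightarrow> 'o"
  ident :: "'o \<Rightarrow> 'm"
  cmp :: "'m \<Rightarrow> 'm \<Rightarrow> 'm" (infixr "\<cdot>\<index>" 75)  \<comment> \<open>\<open>g \<cdot> f\<close> is \<open>f\<close> followed by \<open>g\<close>\<close>
  add :: "'m \<Rightarrow> 'm \<Rightarrow> 'm" (infixl "\<boxplus>\<index>" 65)
  zero_arr :: "'o \<Rightarrow> 'o \<Rightarrow> 'm"

definition homs :: "('o, 'm, 'x) precat_scheme \<Rightarrow> 'o \<Rightarrow> 'o \<Rightarrow> 'm set" where
  "homs C X Y = {f \<in> arrs C. src C f = X \<and> tgt C f = Y}"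

definition hom_group :: "('o, 'm, 'x) precat_scheme \<Rightarrow> 'o \<Rightarrow> 'o \<Rightarrow> 'm monoid" where
  "hom_group C X Y =
     \<lparr>carrier = homs C X Y, monoid.mult = add C, monoid.one = zero_arr C X Y\<rparr>"

definition neg :: "('o, 'm, 'x) precat_scheme \<Rightarrow> 'm \<Rightarrow> 'm" where
  "neg C f = m_inv (hom_group C (src C f) (tgt C f)) f"

locale preadditive_category =
  fixes C :: "('o, 'm, 'x) precat_scheme" (structure)
  assumes src_obj: "f \<in> arrs C \<Longrightarrow> src C f \<in> objs C"
    and tgt_obj: "f \<in> arrs C \<Longrightarrow> tgt C f \<in> objs C"
    and ident_hom: "X \<in> objs C \<Longrightarrow> ident C X \<in> homs C X X"
    and cmp_hom: "\<lbrakk>f \<in> homs C X Y; g \<in> homs C Y Z\<rbrakk> \<Longrightarrow> g \<cdot> f \<in> homs C X Z"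
    and cmp_assoc: "\<lbrakk>f \<in> homs C W X; g \<in> homs C X Y; h \<in> homs C Y Z\<rbrakk>
      \<Longrightarrow> (h \<cdot> g) \<cdot> f = h \<cdot> (g \<cdot> f)"
    and ident_left: "f \<in> homs C X Y \<Longrightarrow> ident C Y \<cdot> f = f"
    and ident_right: "f \<in> homs C X Y \<Longrightarrow> f \<cdot> ident C X = f"
    and hom_comm_group: "\<lbrakk>X \<in> objs C; Y \<in> objs C\<rbrakk> \<Longrightarrow> comm_group (hom_group C X Y)"
    and cmp_add_left: "\<lbrakk>f \<in> homs C X Y; g \<in> homs C Y Z; g' \<in> homs C Y Z\<rbrakk>
      \<Longrightarrow> (g \<boxplus> g') \<cdot> f = (g \<cdot> f) \<boxplus> (g' \<cdot> f)"
    and cmp_add_right: "\<lbrakk>f \<in> homs C X Y; f' \<in> homs C X Y; g \<in> homs C Y Z\<rbrakk>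
      \<Longrightarrow> g \<cdot> (f \<boxplus> f') = (g \<cdot> f) \<boxplus> (g \<cdot> f')"

definition is_zero_object :: "('o, 'm, 'x) precat_scheme \<Rightarrow> 'o \<Rightarrow> bool" where
  "is_zero_object C Z \<longleftrightarrow> Z \<in> objs C \<and>
     (\<forall>X \<in> objs C. (\<exists>!f. f \<in> homs C X Z) \<and> (\<exists>!f. f \<in> homs C Z X))"

definition is_biproduct :: "('o, 'm, 'x) precat_scheme \<Rightarrow> 'o \<Rightarrow> 'o \<Rightarrow> 'o \<Rightarrow> bool" where
  "is_biproduct C X Y S \<longleftrightarrow>
     (\<exists>i \<in> homs C X S. \<exists>j \<in> homs C Y S. \<exists>p \<in> homs C S X. \<exists>q \<in> homs C S Y.
        cmp C p i = ident C X \<and> cmp C q j = ident C Y \<and>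
        cmp C q i = zero_arr C X Y \<and> cmp C p j = zero_arr C Y X \<and>
        add C (cmp C i p) (cmp C j q) = ident C S)"

locale additive_category = preadditive_category +
  assumes ex_zero_object: "\<exists>Z. is_zero_object C Z"
    and ex_biproduct: "\<lbrakk>X \<in> objs C; Y \<in> objs C\<rbrakk> \<Longrightarrow> \<exists>S \<in> objs C. is_biproduct C X Y S"

definition is_iso :: "('o, 'm, 'x) precat_scheme \<Rightarrow> 'm \<Rightarrow> bool" where
  "is_iso C f \<longleftrightarrow> f \<in> arrs C \<and>
     (\<exists>g \<in> homs C (tgt C f) (src C f).
        cmp C g f = ident C (src C f) \<and> cmp C f g = ident C (tgt C f))"

definition isomorphic :: "('o, 'm, 'x) precat_scheme \<Rightarrow> 'o \<Rightarrow> 'o \<Rightarrow> bool" where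
  "isomorphic C X Y \<longleftrightarrow> (\<exists>f \<in> homs C X Y. is_iso C f)"

definition is_retract :: "('o, 'm, 'x) precat_scheme \<Rightarrow> 'o \<Rightarrow> 'o \<Rightarrow> bool" where
  "is_retract C Y X \<longleftrightarrow>
     Y \<in> objs C \<and> (\<exists>i \<in> homs C Y X. \<exists>p \<in> homs C X Y. cmp C p i = ident C Y)"

record ('o, 'm, 'p, 'n) fctr =
  ob :: "'o \<Rightarrow> 'p"
  ar :: "'m \<Rightarrow> 'n"

definition additive_functor ::
  "('o, 'm, 'x) precat_scheme \<Rightarrow> ('p, 'n, 'y) precat_scheme \<Rightarrow>
   ('o, 'm, 'p, 'n, 'z) fctr_scheme \<Rightarrow> bool" where
  "additive_functor C D F \<longleftrightarrow>
     (\<forall>X \<in> objs C. ob F X \<in> objs D) \<and>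
     (\<forall>X Y. \<forall>f \<in> homs C X Y. ar F f \<in> homs D (ob F X) (ob F Y)) \<and>
     (\<forall>X \<in> objs C. ar F (ident C X) = ident D (ob F X)) \<and>
     (\<forall>X Y Z. \<forall>f \<in> homs C X Y. \<forall>g \<in> homs C Y Z.
        ar F (cmp C g f) = cmp D (ar F g) (ar F f)) \<and>
     (\<forall>X Y. \<forall>f \<in> homs C X Y. \<forall>g \<in> homs C X Y.
        ar F (add C f g) = add D (ar F f) (ar F g))"

text \<open>\<open>L : A \<rightarrow> B\<close> is left adjoint to \<open>R : B \<rightarrow> A\<close>.\<close>

definition left_adjoint_to ::
  "('o, 'm, 'x) precat_scheme \<Rightarrow> ('p, 'n, 'y) precat_scheme \<Rightarrow>
   ('o, 'm, 'p, 'n, 'z) fctr_scheme \<Rightarrow> ('p, 'n, 'o, 'm, 'u) fctr_scheme \<Rightarrow> bool" where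
  "left_adjoint_to A B L R \<longleftrightarrow>
     (\<exists>\<Phi> :: 'o \<Rightarrow> 'p \<Rightarrow> 'n \<Rightarrow> 'm.
        (\<forall>X \<in> objs A. \<forall>Y \<in> objs B.
           bij_betw (\<Phi> X Y) (homs B (ob L X) Y) (homs A X (ob R Y))) \<and>
        (\<forall>X' X Y Y'. \<forall>h \<in> homs A X' X. \<forall>f \<in> homs B (ob L X) Y. \<forall>k \<in> homs B Y Y'.
           \<Phi> X' Y' (cmp B k (cmp B f (ar L h))) = cmp A (ar R k) (cmp A (\<Phi> X Y f) h)))"

text \<open>A triangle \<open>X \<rightarrow> Y \<rightarrow> Z \<rightarrow> X[1]\<close> is encoded by its three arrows.\<close>

record ('o, 'm) tricat = "('o, 'm) precat" +
  shift :: "('o, 'm, 'o, 'm) fctr"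
  dist :: "('m \<times> 'm \<times> 'm) set"

abbreviation shift_ob :: "('o, 'm, 'x) tricat_scheme \<Rightarrow> 'o \<Rightarrow> 'o" where
  "shift_ob C X \<equiv> ob (shift C) X"

abbreviation shift_ar :: "('o, 'm, 'x) tricat_scheme \<Rightarrow> 'm \<Rightarrow> 'm" where
  "shift_ar C f \<equiv> ar (shift C) f"

text \<open>The object \<open>X[-1]\<close>; the translation is required below to be an automorphism.\<close>

definition unshift_ob :: "('o, 'm, 'x) tricat_scheme \<Rightarrow> 'o \<Rightarrow> 'o" where
  "unshift_ob C X = inv_into (objs C) (ob (shift C)) X"

definition triangle ::
  "('o, 'm, 'x) tricat_scheme \<Rightarrow> 'o \<Rightarrow> 'o \<Rightarrow> 'o \<Rightarrow> 'm \<Rightarrow> 'm \<Rightarrow> 'm \<Rightarrow> bool" where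
  "triangle C X Y Z f g h \<longleftrightarrow>
     f \<in> homs C X Y \<and> g \<in> homs C Y Z \<and> h \<in> homs C Z (shift_ob C X)"

definition dtriangle ::
  "('o, 'm, 'x) tricat_scheme \<Rightarrow> 'o \<Rightarrow> 'o \<Rightarrow> 'o \<Rightarrow> 'm \<Rightarrow> 'm \<Rightarrow> 'm \<Rightarrow> bool" where
  "dtriangle C X Y Z f g h \<longleftrightarrow> triangle C X Y Z f g h \<and> (f, g, h) \<in> dist C"

locale triangulated_category = additive_category C
  for C :: "('o, 'm, 'x) tricat_scheme" (structure) +
  assumes shift_functor: "additive_functor C C (shift C)"
    and shift_ob_bij: "bij_betw (ob (shift C)) (objs C) (objs C)"
    and shift_ar_bij: "bij_betw (ar (shift C)) (arrs C) (arrs C)"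
    and dist_triangle: "(f, g, h) \<in> dist C \<Longrightarrow> \<exists>X Y Z. triangle C X Y Z f g h"
    and TR1_ident: "\<lbrakk>X \<in> objs C; is_zero_object C N\<rbrakk>
      \<Longrightarrow> dtriangle C X X N (ident C X) (zero_arr C X N) (zero_arr C N (shift_ob C X))"
    and TR1_iso: "\<lbrakk>dtriangle C X Y Z f g h; triangle C X' Y' Z' f' g' h';
        a \<in> homs C X X'; b \<in> homs C Y Y'; c \<in> homs C Z Z';
        is_iso C a; is_iso C b; is_iso C c;
        b \<cdot> f = f' \<cdot> a; c \<cdot> g = g' \<cdot> b; shift_ar C a \<cdot> h = h' \<cdot> c\<rbrakk>
      \<Longrightarrow> dtriangle C X' Y' Z' f' g' h'"
    and TR1_cone: "f \<in> homs C X Y \<Longrightarrow> \<exists>Z g h. dtriangle C X Y Z f g h"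
    and TR2: "triangle C X Y Z f g h
      \<Longrightarrow> dtriangle C X Y Z f g h \<longleftrightarrow> dtriangle C Y Z (shift_ob C X) g h (neg C (shift_ar C f))"
    and TR3: "\<lbrakk>dtriangle C X Y Z f g h; dtriangle C X' Y' Z' f' g' h';
        a \<in> homs C X X'; b \<in> homs C Y Y'; b \<cdot> f = f' \<cdot> a\<rbrakk>
      \<Longrightarrow> \<exists>c \<in> homs C Z Z'. c \<cdot> g = g' \<cdot> b \<and> shift_ar C a \<cdot> h = h' \<cdot> c"
    and TR4: "\<lbrakk>dtriangle C X Y Z' f j k; dtriangle C Y Z X' g l i;
        dtriangle C X Z Y' (g \<cdot> f) m n\<rbrakk>
      \<Longrightarrow> \<exists>u v. dtriangle C Z' Y' X' u v (shift_ar C j \<cdot> i) \<and>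
            u \<cdot> j = m \<cdot> g \<and> n \<cdot> u = k \<and> v \<cdot> m = l \<and> i \<cdot> v = shift_ar C f \<cdot> n"

text \<open>An exact functor carries comparison isomorphisms \<open>F(X[1]) \<rightarrow> F(X)[1]\<close> as part of its data.\<close>

record ('o, 'm, 'p, 'n) exfun = "('o, 'm, 'p, 'n) fctr" +
  comparison :: "'o \<Rightarrow> 'n"

definition exact_functor ::
  "('o, 'm, 'x) tricat_scheme \<Rightarrow> ('p, 'n, 'y) tricat_scheme \<Rightarrow>
   ('o, 'm, 'p, 'n, 'z) exfun_scheme \<Rightarrow> bool" where
  "exact_functor C D F \<longleftrightarrow>
     additive_functor C D F \<and>
     (\<forall>X \<in> objs C.
        comparison F X \<in> homs D (ob F (shift_ob C X)) (shift_ob D (ob F X)) \<and>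
        is_iso D (comparison F X)) \<and>
     (\<forall>X Y. \<forall>f \<in> homs C X Y.
        cmp D (comparison F Y) (ar F (shift_ar C f)) =
        cmp D (shift_ar D (ar F f)) (comparison F X)) \<and>
     (\<forall>X Y Z f g h. dtriangle C X Y Z f g h \<longrightarrow>
        dtriangle D (ob F X) (ob F Y) (ob F Z)
          (ar F f) (ar F g) (cmp D (comparison F X) (ar F h)))"

text \<open>The composite \<open>G \<circ> F\<close>; the argument \<open>E\<close> is the target category of \<open>G\<close>, needed to compose
  the comparison isomorphisms \<open>GF(X[1]) \<rightarrow> G(F(X)[1]) \<rightarrow> GF(X)[1]\<close>.\<close>

definition exfun_comp ::
  "('q, 'k, 'x) tricat_scheme \<Rightarrow> ('p, 'n, 'q, 'k) exfun \<Rightarrow> ('o, 'm, 'p, 'n) exfun \<Rightarrow>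
   ('o, 'm, 'q, 'k) exfun" where
  "exfun_comp E G F =
     \<lparr>ob = ob G \<circ> ob F, ar = ar G \<circ> ar F,
      comparison = (\<lambda>X. cmp E (comparison G (ob F X)) (ar G (comparison F X)))\<rparr>"

definition orthogonal ::
  "('o, 'm, 'x) precat_scheme \<Rightarrow> 'o set \<Rightarrow> 'o set \<Rightarrow> bool" where
  "orthogonal C D E \<longleftrightarrow> (\<forall>X \<in> D. \<forall>Y \<in> E. homs C X Y = {zero_arr C X Y})"

definition additive_class :: "('o, 'm, 'x) precat_scheme \<Rightarrow> 'o set \<Rightarrow> bool" where
  "additive_class C D \<longleftrightarrow> (\<exists>Z \<in> D. is_zero_object C Z) \<and>
     (\<forall>X \<in> D. \<forall>Y \<in> D. \<forall>S \<in> objs C. is_biproduct C X Y S \<longrightarrow> S \<in> D)"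

definition Karoubi_closed :: "('o, 'm, 'x) precat_scheme \<Rightarrow> 'o set \<Rightarrow> bool" where
  "Karoubi_closed C D \<longleftrightarrow> (\<forall>X \<in> D. \<forall>Y. is_retract C Y X \<longrightarrow> Y \<in> D)"

definition iso_closed :: "('o, 'm, 'x) precat_scheme \<Rightarrow> 'o set \<Rightarrow> bool" where
  "iso_closed C D \<longleftrightarrow> (\<forall>X \<in> D. \<forall>Y. isomorphic C X Y \<longrightarrow> Y \<in> D)"

text \<open>A pair of classes of objects, used both for weight structures and for t-structures:
  \<open>le_part w\<close> is the class with superscript \<open>w \<le> 0\<close>, \<open>ge_part w\<close> the one with \<open>w \<ge> 0\<close>.\<close>

record 'o class_pair =
  le_part :: "'o set"
  ge_part :: "'o set"

definition weight_structure :: "('o, 'm, 'x) tricat_scheme \<Rightarrow> 'o class_pair \<Rightarrow> bool" where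
  "weight_structure C w \<longleftrightarrow>
     le_part w \<subseteq> objs C \<and> ge_part w \<subseteq> objs C \<and>
     additive_class C (le_part w) \<and> additive_class C (ge_part w) \<and>
     Karoubi_closed C (le_part w) \<and> Karoubi_closed C (ge_part w) \<and>
     ge_part w \<subseteq> shift_ob C ` ge_part w \<and>
     shift_ob C ` le_part w \<subseteq> le_part w \<and>
     orthogonal C (ge_part w) (shift_ob C ` le_part w) \<and>
     (\<forall>X \<in> objs C. \<exists>A \<in> le_part w. \<exists>B \<in> ge_part w. \<exists>f g h.
        dtriangle C (unshift_ob C B) X A f g h \<and> h \<in> homs C A B)"

definition t_structure :: "('o, 'm, 'x) tricat_scheme \<Rightarrow> 'o class_pair \<Rightarrow> bool" where
  "t_structure C t \<longleftrightarrow>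
     le_part t \<subseteq> objs C \<and> ge_part t \<subseteq> objs C \<and>
     iso_closed C (le_part t) \<and> iso_closed C (ge_part t) \<and>
     ge_part t \<subseteq> shift_ob C ` ge_part t \<and>
     shift_ob C ` le_part t \<subseteq> le_part t \<and>
     orthogonal C (shift_ob C ` le_part t) (ge_part t) \<and>
     (\<forall>X \<in> objs C. \<exists>A \<in> le_part t. \<exists>B \<in> unshift_ob C ` ge_part t. \<exists>f g h.
        dtriangle C A X B f g h)"

definition left_adjacent :: "'o class_pair \<Rightarrow> 'o class_pair \<Rightarrow> bool" where
  "left_adjacent w t \<longleftrightarrow> le_part w = le_part t"

definition right_adjacent :: "'o class_pair \<Rightarrow> 'o class_pair \<Rightarrow> bool" where
  "right_adjacent w t \<longleftrightarrow> ge_part w = ge_part t"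

definition t_exact ::
  "('o, 'm, 'x) tricat_scheme \<Rightarrow> 'o class_pair \<Rightarrow> ('p, 'n, 'y) tricat_scheme \<Rightarrow> 'p class_pair \<Rightarrow>
   ('o, 'm, 'p, 'n) exfun \<Rightarrow> bool" where
  "t_exact C t C' t' F \<longleftrightarrow> exact_functor C C' F \<and>
     ob F ` le_part t \<subseteq> le_part t' \<and> ob F ` ge_part t \<subseteq> ge_part t'"

definition weight_exact ::
  "('o, 'm, 'x) tricat_scheme \<Rightarrow> 'o class_pair \<Rightarrow> ('p, 'n, 'y) tricat_scheme \<Rightarrow> 'p class_pair \<Rightarrow>
   ('o, 'm, 'p, 'n) exfun \<Rightarrow> bool" where
  "weight_exact C w C' w' F \<longleftrightarrow> exact_functor C C' F \<and>
     ob F ` le_part w \<subseteq> le_part w' \<and> ob F ` ge_part w \<subseteq> ge_part w'"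

end

theory Submission
  imports Defs
begin

text \<open>
  Each half of a t-structure or a weight structure is the orthogonal complement of a shift of the
  other half: the decomposition triangle of an object orthogonal to the relevant class splits,
  exhibiting the object as a retract of its truncation (and, for t-structures, as isomorphic to it).
  Since an adjunction turns orthogonality on one side into orthogonality on the other and exact
  functors commute with the shift, a left adjoint respects the left half of a t-structure if and
  only if its right adjoint respects the right half, and dually for weight structures. When the
  structures are adjacent, the two resulting equivalences combine into the claim.
\<close>

section \<open>Preadditive categories\<close>

lemma homsI: "\<lbrakk>f \<in> arrs C; src C f = X; tgt C f = Y\<rbrakk> \<Longrightarrow> f \<in> homs C X Y"
  by (simp add: homs_def)

lemma homsD:
  assumes "f \<in> homs C X Y"
  shows "f \<in> arrs C" "src C f = X" "tgt C f = Y"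
  using assms by (auto simp: homs_def)

lemma is_isoI:
  assumes "f \<in> homs C X Y" "g \<in> homs C Y X" "cmp C g f = ident C X" "cmp C f g = ident C Y"
  shows "is_iso C f"
  using assms unfolding is_iso_def by (auto simp: homs_def)

lemma is_isoE:
  assumes "is_iso C f" "f \<in> homs C X Y"
  obtains g where "g \<in> homs C Y X" "cmp C g f = ident C X" "cmp C f g = ident C Y"
  using assms unfolding is_iso_def by (auto simp: homs_def)

text \<open>The objectwise form of \<open>orthogonal\<close>. Transport along isomorphisms, the
  shift and an adjunction is argued for one pair of objects at a time.\<close>

definition perp :: "('o, 'm, 'x) precat_scheme \<Rightarrow> 'o \<Rightarrow> 'o \<Rightarrow> bool" where
  "perp C X Y \<longleftrightarrow> homs C X Y = {zero_arr C X Y}"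

lemma orthogonal_iff_perp: "orthogonal C D E \<longleftrightarrow> (\<forall>X \<in> D. \<forall>Y \<in> E. perp C X Y)"
  by (simp add: orthogonal_def perp_def)

lemma perpD: "perp C X Y \<Longrightarrow> f \<in> homs C X Y \<Longrightarrow> f = zero_arr C X Y"
  by (simp add: perp_def)

context preadditive_category
begin

lemma homs_objs:
  assumes "f \<in> homs C X Y"
  shows "X \<in> objs C" "Y \<in> objs C"
  using assms src_obj tgt_obj by (auto simp: homs_def)

lemma hom_group_simps [simp]:
  "carrier (hom_group C X Y) = homs C X Y"
  "f \<otimes>\<^bsub>hom_group C X Y\<^esub> g = add C f g"
  "\<one>\<^bsub>hom_group C X Y\<^esub> = zero_arr C X Y"
  by (simp_all add: hom_group_def)

lemma zero_hom: "\<lbrakk>X \<in> objs C; Y \<in> objs C\<rbrakk> \<Longrightarrow> zero_arr C X Y \<in> homs C X Y"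
  using hom_comm_group[of X Y] comm_group.axioms(2) group.is_monoid monoid.one_closed hom_group_simps
  by metis

lemma add_zero_left: "f \<in> homs C X Y \<Longrightarrow> zero_arr C X Y \<boxplus> f = f"
  using hom_comm_group[of X Y] comm_group.axioms(2) group.is_monoid monoid.l_one hom_group_simps
    homs_objs by metis

lemma add_hom: "\<lbrakk>f \<in> homs C X Y; g \<in> homs C X Y\<rbrakk> \<Longrightarrow> f \<boxplus> g \<in> homs C X Y"
  using hom_comm_group[of X Y] comm_group.axioms(2) group.is_monoid monoid.m_closed hom_group_simps
    homs_objs by metis

lemma neg_hom:
  assumes "f \<in> homs C X Y"
  shows "neg C f \<in> homs C X Y"
proof -
  interpret group "hom_group C X Y"
    using hom_comm_group homs_objs[OF assms] comm_group.axioms(2) by blast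
  show ?thesis using inv_closed[of f] assms homsD[OF assms] by (simp add: neg_def)
qed

lemma add_neg:
  assumes "f \<in> homs C X Y"
  shows "f \<boxplus> neg C f = zero_arr C X Y"
proof -
  interpret group "hom_group C X Y"
    using hom_comm_group homs_objs[OF assms] comm_group.axioms(2) by blast
  show ?thesis using r_inv[of f] assms homsD[OF assms] by (simp add: neg_def)
qed

lemma neg_unique:
  assumes "f \<in> homs C X Y" "g \<in> homs C X Y" "f \<boxplus> g = zero_arr C X Y"
  shows "g = neg C f"
proof -
  interpret comm_group "hom_group C X Y"
    using hom_comm_group homs_objs[OF assms(1)] by blast
  show ?thesis using inv_unique'[of f g] assms m_comm[of f g] homsD[OF assms(1)]
    by (simp add: neg_def)
qed

lemma neg_neg:
  assumes "f \<in> homs C X Y"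
  shows "neg C (neg C f) = f"
proof -
  interpret group "hom_group C X Y"
    using hom_comm_group homs_objs[OF assms] comm_group.axioms(2) by blast
  show ?thesis using inv_inv[of f] assms homsD[OF assms] homsD[OF neg_hom[OF assms]]
    by (simp add: neg_def)
qed

text \<open>Cancellation in the hom group. Neither composition nor additive functors are postulated
  to preserve zero arrows; additivity sends zero to an element equal to its own double, which this
  lemma identifies.\<close>

lemma idempotent_zero:
  assumes "f \<in> homs C X Y" "f \<boxplus> f = f"
  shows "f = zero_arr C X Y"
proof -
  interpret group "hom_group C X Y"
    using hom_comm_group homs_objs[OF assms(1)] comm_group.axioms(2) by blast
  show ?thesis using r_cancel_one[of f f] assms by simp
qed

lemma neg_zero: "\<lbrakk>X \<in> objs C; Y \<in> objs C\<rbrakk> \<Longrightarrow> neg C (zero_arr C X Y) = zero_arr C X Y"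
  using neg_unique zero_hom add_zero_left by metis

lemma eq_if_add_neg_zero:
  assumes "f \<in> homs C X Y" "g \<in> homs C X Y" "f \<boxplus> neg C g = zero_arr C X Y"
  shows "f = g"
  using neg_unique[OF assms(1) neg_hom[OF assms(2)] assms(3)] neg_neg assms by metis

lemma cmp_zero_left:
  assumes "f \<in> homs C X Y" "Z \<in> objs C"
  shows "zero_arr C Y Z \<cdot> f = zero_arr C X Z"
proof -
  have z: "zero_arr C Y Z \<in> homs C Y Z" using assms homs_objs zero_hom by blast
  show ?thesis
    using idempotent_zero[OF cmp_hom[OF assms(1) z]] cmp_add_left[OF assms(1) z z]
      add_zero_left[OF z] by simp
qed

lemma cmp_zero_right:
  assumes "g \<in> homs C Y Z" "X \<in> objs C"
  shows "g \<cdot> zero_arr C X Y = zero_arr C X Z"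
proof -
  have z: "zero_arr C X Y \<in> homs C X Y" using assms homs_objs zero_hom by blast
  show ?thesis
    using idempotent_zero[OF cmp_hom[OF z assms(1)]] cmp_add_right[OF z z assms(1)]
      add_zero_left[OF z] by simp
qed

lemma cmp_neg_right:
  assumes "f \<in> homs C X Y" "g \<in> homs C Y Z"
  shows "g \<cdot> neg C f = neg C (g \<cdot> f)"
  by (rule neg_unique[OF cmp_hom[OF assms] cmp_hom[OF neg_hom[OF assms(1)] assms(2)]])
    (use cmp_add_right[OF assms(1) neg_hom[OF assms(1)] assms(2)] add_neg[OF assms(1)]
      cmp_zero_right[OF assms(2)] homs_objs[OF assms(1)] in simp)

lemma cmp_neg_left:
  assumes "f \<in> homs C X Y" "g \<in> homs C Y Z"
  shows "neg C g \<cdot> f = neg C (g \<cdot> f)"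
  by (rule neg_unique[OF cmp_hom[OF assms] cmp_hom[OF assms(1) neg_hom[OF assms(2)]]])
    (use cmp_add_left[OF assms(1,2) neg_hom[OF assms(2)]] add_neg[OF assms(2)]
      cmp_zero_left[OF assms(1)] homs_objs[OF assms(2)] in simp)

lemma perpI:
  assumes "X \<in> objs C" "Y \<in> objs C" "\<And>f. f \<in> homs C X Y \<Longrightarrow> f = zero_arr C X Y"
  shows "perp C X Y"
  using assms zero_hom by (auto simp: perp_def)

text \<open>Expresses vanishing by the size of the hom set alone, so that a bare bijection of hom
  sets, with no additivity known, transports it.\<close>

lemma perp_iff_singleton:
  assumes "X \<in> objs C" "Y \<in> objs C"
  shows "perp C X Y \<longleftrightarrow> is_singleton (homs C X Y)"
  using zero_hom[OF assms] by (auto simp: perp_def is_singleton_def)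

lemma perp_iso_left:
  assumes "\<phi> \<in> homs C X X'" "is_iso C \<phi>" "Y \<in> objs C"
  shows "perp C X Y \<longleftrightarrow> perp C X' Y"
proof -
  obtain \<psi> where \<psi>: "\<psi> \<in> homs C X' X" "\<psi> \<cdot> \<phi> = ident C X" "\<phi> \<cdot> \<psi> = ident C X'"
    using assms is_isoE by metis
  \<comment> \<open>The maps \<open>a\<close> and \<open>b\<close> exhibit \<open>V\<close> as a
    retract of \<open>U\<close>, and vanishing passes to retracts. An isomorphism makes each object
    a retract of the other, which gives both directions.\<close>
  have transfer: "perp C V Y"
    if perp: "perp C U Y" and a: "a \<in> homs C U V" and b: "b \<in> homs C V U" and
      ab: "a \<cdot> b = ident C V" for U V a b
  proof (rule perpI)
    fix f assume f: "f \<in> homs C V Y"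
    have "f = (f \<cdot> a) \<cdot> b" using ident_right f ab cmp_assoc[OF b a f] by simp
    also have "\<dots> = zero_arr C V Y"
      using perpD[OF perp cmp_hom[OF a f]] cmp_zero_left[OF b assms(3)] by simp
    finally show "f = zero_arr C V Y" .
  qed (use homs_objs[OF b] assms in auto)
  show ?thesis using transfer \<psi> assms by blast
qed

lemma perp_iso_right:
  assumes "\<phi> \<in> homs C Y Y'" "is_iso C \<phi>" "X \<in> objs C"
  shows "perp C X Y \<longleftrightarrow> perp C X Y'"
proof -
  obtain \<psi> where \<psi>: "\<psi> \<in> homs C Y' Y" "\<psi> \<cdot> \<phi> = ident C Y" "\<phi> \<cdot> \<psi> = ident C Y'"
    using assms is_isoE by metis
  have transfer: "perp C X V"
    if perp: "perp C X U" and a: "a \<in> homs C U V" and b: "b \<in> homs C V U" and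
      ab: "a \<cdot> b = ident C V" for U V a b
  proof (rule perpI)
    fix f assume f: "f \<in> homs C X V"
    have "f = a \<cdot> (b \<cdot> f)" using ident_left f ab cmp_assoc[OF f b a] by simp
    also have "\<dots> = zero_arr C X V"
      using perpD[OF perp cmp_hom[OF f b]] cmp_zero_right[OF a assms(3)] by simp
    finally show "f = zero_arr C X V" .
  qed (use homs_objs[OF b] assms in auto)
  show ?thesis using transfer \<psi> assms by blast
qed

lemma zero_object_unique:
  assumes "is_zero_object C N" "f \<in> homs C X N" "g \<in> homs C X N"
  shows "f = g"
  using assms homs_objs(1)[OF assms(2)] unfolding is_zero_object_def by blast

text \<open>Replaces the universal property by one equation between arrows, which the shift visibly
  preserves.\<close>

lemma zero_object_iff: "is_zero_object C N \<longleftrightarrow> N \<in> objs C \<and> ident C N = zero_arr C N N"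
proof
  assume "is_zero_object C N"
  then show "N \<in> objs C \<and> ident C N = zero_arr C N N"
    using zero_object_unique ident_hom zero_hom by (metis is_zero_object_def)
next
  assume N: "N \<in> objs C \<and> ident C N = zero_arr C N N"
  show "is_zero_object C N" unfolding is_zero_object_def
  proof (intro conjI ballI)
    fix X assume X: "X \<in> objs C"
    show "\<exists>!f. f \<in> homs C X N"
      using zero_hom[OF X] N ident_left cmp_zero_left by metis
    show "\<exists>!f. f \<in> homs C N X"
      using zero_hom[OF _ X] N ident_right cmp_zero_right by metis
  qed (use N in blast)
qed

end

section \<open>Additive functors\<close>

lemma additive_functorD:
  assumes "additive_functor C D F"
  shows "X \<in> objs C \<Longrightarrow> ob F X \<in> objs D"
    and "f \<in> homs C X Y \<Longrightarrow> ar F f \<in> homs D (ob F X) (ob F Y)"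
    and "X \<in> objs C \<Longrightarrow> ar F (ident C X) = ident D (ob F X)"
    and "\<lbrakk>f \<in> homs C X Y; g \<in> homs C Y Z\<rbrakk> \<Longrightarrow> ar F (cmp C g f) = cmp D (ar F g) (ar F f)"
    and "\<lbrakk>f \<in> homs C X Y; g \<in> homs C X Y\<rbrakk> \<Longrightarrow> ar F (add C f g) = add D (ar F f) (ar F g)"
  using assms unfolding additive_functor_def by blast+

lemma additive_functor_zero:
  assumes "preadditive_category C" "preadditive_category D" "additive_functor C D F"
    "X \<in> objs C" "Y \<in> objs C"
  shows "ar F (zero_arr C X Y) = zero_arr D (ob F X) (ob F Y)"
proof -
  interpret C: preadditive_category C by fact
  interpret D: preadditive_category D by fact
  have z: "zero_arr C X Y \<in> homs C X Y" using C.zero_hom assms by blast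
  show ?thesis
    using D.idempotent_zero additive_functorD(2)[OF assms(3) z]
      additive_functorD(5)[OF assms(3) z z] C.add_zero_left[OF z] by metis
qed

lemma additive_functor_iso:
  assumes "additive_functor C D F" "preadditive_category C" "\<phi> \<in> homs C X Y" "is_iso C \<phi>"
  shows "is_iso D (ar F \<phi>)"
proof -
  interpret C: preadditive_category C by fact
  obtain \<psi> where \<psi>: "\<psi> \<in> homs C Y X" "cmp C \<psi> \<phi> = ident C X" "cmp C \<phi> \<psi> = ident C Y"
    using assms is_isoE by metis
  note F = additive_functorD[OF assms(1)]
  show ?thesis
  proof (rule is_isoI)
    show "cmp D (ar F \<psi>) (ar F \<phi>) = ident D (ob F X)"
      using F(4)[OF assms(3) \<psi>(1)] F(3) \<psi>(2) C.homs_objs[OF assms(3)] by simp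
    show "cmp D (ar F \<phi>) (ar F \<psi>) = ident D (ob F Y)"
      using F(4)[OF \<psi>(1) assms(3)] F(3) \<psi>(3) C.homs_objs[OF assms(3)] by simp
  qed (use F(2) assms(3) \<psi>(1) in auto)
qed

lemma (in preadditive_category) is_iso_cmp:
  assumes f: "f \<in> homs C X Y" "is_iso C f" and g: "g \<in> homs C Y Z" "is_iso C g"
  shows "is_iso C (g \<cdot> f)"
proof -
  obtain f' where f': "f' \<in> homs C Y X" "f' \<cdot> f = ident C X" "f \<cdot> f' = ident C Y"
    using f is_isoE by metis
  obtain g' where g': "g' \<in> homs C Z Y" "g' \<cdot> g = ident C Y" "g \<cdot> g' = ident C Z"
    using g is_isoE by metis
  have gf: "g \<cdot> f \<in> homs C X Z" using cmp_hom[OF f(1) g(1)] .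
  show ?thesis
  proof (rule is_isoI)
    show "(f' \<cdot> g') \<cdot> (g \<cdot> f) = ident C X"
      using cmp_assoc[OF gf g'(1) f'(1)] cmp_assoc[OF f(1) g(1) g'(1)] g'(2) f'(2) ident_left[OF f(1)]
      by simp
    show "(g \<cdot> f) \<cdot> (f' \<cdot> g') = ident C Z"
      using cmp_assoc[OF cmp_hom[OF g'(1) f'(1)] f(1) g(1)] cmp_assoc[OF g'(1) f'(1) f(1)]
        g'(3) f'(3) ident_left[OF g'(1)]
      by simp
  qed (fact gf cmp_hom[OF g'(1) f'(1)])+
qed

section \<open>Triangulated categories\<close>

context triangulated_category
begin

lemma preadditive: "preadditive_category C" ..

lemmas shiftD = additive_functorD[OF shift_functor]

lemma shift_zero:
  "\<lbrakk>X \<in> objs C; Y \<in> objs C\<rbrakk>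
    \<Longrightarrow> shift_ar C (zero_arr C X Y) = zero_arr C (shift_ob C X) (shift_ob C Y)"
  using additive_functor_zero[OF preadditive preadditive shift_functor] .

lemma shift_faithful:
  "\<lbrakk>f \<in> homs C X Y; g \<in> homs C X' Y'; shift_ar C f = shift_ar C g\<rbrakk> \<Longrightarrow> f = g"
  using shift_ar_bij by (auto simp: bij_betw_def inj_on_def homs_def)

text \<open>Surjectivity on all arrows yields a preimage whose source and target are unknown;
  injectivity of the shift on objects then forces them to be \<open>X\<close> and
  \<open>Y\<close>.\<close>

lemma shift_full:
  assumes "X \<in> objs C" "Y \<in> objs C" "c \<in> homs C (shift_ob C X) (shift_ob C Y)"
  obtains l where "l \<in> homs C X Y" "shift_ar C l = c"
proof -
  obtain l where l: "l \<in> arrs C" "shift_ar C l = c"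
    using shift_ar_bij homsD(1)[OF assms(3)] by (metis bij_betw_def imageE)
  have "c \<in> homs C (shift_ob C (src C l)) (shift_ob C (tgt C l))"
    using shiftD(2) l homsI by metis
  then have "shift_ob C (src C l) = shift_ob C X" "shift_ob C (tgt C l) = shift_ob C Y"
    using assms(3) by (auto simp: homs_def)
  then have "src C l = X" "tgt C l = Y"
    using shift_ob_bij assms src_obj tgt_obj l by (auto simp: bij_betw_def inj_on_def)
  then show thesis using that l homsI by metis
qed

lemma unshift_ob:
  assumes "X \<in> objs C"
  shows "unshift_ob C X \<in> objs C" "shift_ob C (unshift_ob C X) = X"
  using assms shift_ob_bij inv_into_into[of X "shift_ob C" "objs C"]
    f_inv_into_f[of X "shift_ob C" "objs C"]
  by (auto simp: unshift_ob_def bij_betw_def)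

lemma perp_shift:
  assumes "X \<in> objs C" "Y \<in> objs C"
  shows "perp C (shift_ob C X) (shift_ob C Y) \<longleftrightarrow> perp C X Y"
proof
  assume perp: "perp C (shift_ob C X) (shift_ob C Y)"
  show "perp C X Y"
  proof (rule perpI[OF assms])
    fix f assume f: "f \<in> homs C X Y"
    show "f = zero_arr C X Y"
      using perpD[OF perp shiftD(2)[OF f]] shift_zero[OF assms] shift_faithful[OF f zero_hom[OF assms]]
      by simp
  qed
next
  assume perp: "perp C X Y"
  show "perp C (shift_ob C X) (shift_ob C Y)"
  proof (rule perpI)
    fix c assume "c \<in> homs C (shift_ob C X) (shift_ob C Y)"
    then obtain l where "l \<in> homs C X Y" "shift_ar C l = c" using shift_full assms by metis
    then show "c = zero_arr C (shift_ob C X) (shift_ob C Y)"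
      using perpD[OF perp] shift_zero[OF assms] by metis
  qed (use shiftD(1) assms in auto)
qed

section \<open>Exactness and splitting of distinguished triangles\<close>

lemma dtriangle_homs:
  assumes "dtriangle C X Y Z f g h"
  shows "f \<in> homs C X Y" "g \<in> homs C Y Z" "h \<in> homs C Z (shift_ob C X)"
  using assms by (auto simp: dtriangle_def triangle_def)

lemma dtriangle_rotate:
  assumes "dtriangle C X Y Z f g h"
  shows "dtriangle C Y Z (shift_ob C X) g h (neg C (shift_ar C f))"
  using assms TR2[of X Y Z f g h] by (auto simp: dtriangle_def)

lemma shift_zero_object:
  assumes "is_zero_object C N"
  shows "is_zero_object C (shift_ob C N)"
  using assms shiftD(1) shiftD(3) shift_zero zero_object_iff by metis

text \<open>Rotating this triangle forward once gives the identity triangle of \<open>W\<close> with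
  the zero object \<open>N[1]\<close>, so \<open>TR2\<close> read backwards applies.\<close>

lemma dtriangle_zero_ident:
  assumes W: "W \<in> objs C" and N: "is_zero_object C N"
  shows "dtriangle C N W W (zero_arr C N W) (ident C W) (zero_arr C W (shift_ob C N))"
proof -
  have Nobj: "N \<in> objs C" using N by (simp add: is_zero_object_def)
  have SN: "is_zero_object C (shift_ob C N)" using shift_zero_object N .
  have SNobj: "shift_ob C N \<in> objs C" using shiftD(1) Nobj .
  have "triangle C N W W (zero_arr C N W) (ident C W) (zero_arr C W (shift_ob C N))"
    using W Nobj SNobj zero_hom ident_hom by (simp add: triangle_def)
  moreover have "neg C (shift_ar C (zero_arr C N W)) = zero_arr C (shift_ob C N) (shift_ob C W)"
    using shift_zero neg_zero W Nobj shiftD(1) by simp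
  ultimately show ?thesis using TR2 TR1_ident[OF W SN] by simp
qed

text \<open>The arrow \<open>g\<close> is a weak cokernel of \<open>f\<close>: the maps
  \<open>X \<rightarrow> N\<close> and \<open>k\<close> form a commuting square into the triangle
  \<open>N \<rightarrow> W \<rightarrow> W\<close>, and the third map supplied by \<open>TR3\<close>
  is the extension.\<close>

lemma dtriangle_extend:
  assumes d: "dtriangle C X Y Z f g h" and k: "k \<in> homs C Y W" "k \<cdot> f = zero_arr C X W"
  obtains l where "l \<in> homs C Z W" "l \<cdot> g = k"
proof -
  obtain N where N: "is_zero_object C N" using ex_zero_object by blast
  have Nobj: "N \<in> objs C" using N by (simp add: is_zero_object_def)
  have W: "W \<in> objs C" and X: "X \<in> objs C"
    using k homs_objs dtriangle_homs[OF d] by blast+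
  have "k \<cdot> f = zero_arr C N W \<cdot> zero_arr C X N"
    using k cmp_zero_left[OF zero_hom[OF X Nobj] W] by simp
  then obtain c where "c \<in> homs C Z W" "c \<cdot> g = ident C W \<cdot> k"
    using TR3[OF d dtriangle_zero_ident[OF W N] zero_hom[OF X Nobj] k(1)] by blast
  then show thesis using that ident_left k by metis
qed

text \<open>The dual weak kernel property. Since \<open>TR3\<close> only produces a third map, both
  triangles are rotated so that the wanted arrow appears there in shifted form, and fullness of the
  shift brings it back.\<close>

lemma dtriangle_lift:
  assumes d: "dtriangle C X Y Z f g h" and m: "m \<in> homs C W Y" "g \<cdot> m = zero_arr C W Z"
  obtains l where "l \<in> homs C W X" "f \<cdot> l = m"
proof -
  obtain N where N: "is_zero_object C N" using ex_zero_object by blast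
  have Nobj: "N \<in> objs C" using N by (simp add: is_zero_object_def)
  note tri = dtriangle_homs[OF d]
  have W: "W \<in> objs C" and X: "X \<in> objs C" and Y: "Y \<in> objs C" and Z: "Z \<in> objs C"
    using m homs_objs tri by blast+
  have W1: "shift_ob C W \<in> objs C" using W shiftD(1) by blast
  have "zero_arr C N Z \<cdot> zero_arr C W N = g \<cdot> m"
    using m cmp_zero_left[OF zero_hom[OF W Nobj] Z] by simp
  \<comment> \<open>The morphism goes from the rotated identity triangle
    \<open>W \<rightarrow> N \<rightarrow> W[1]\<close> to
    \<open>Y \<rightarrow> Z \<rightarrow> X[1]\<close>, with first two components \<open>m\<close>
    and zero.\<close>
  then obtain c where c: "c \<in> homs C (shift_ob C W) (shift_ob C X)"
    and sq: "shift_ar C m \<cdot> neg C (shift_ar C (ident C W)) = neg C (shift_ar C f) \<cdot> c"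
    using TR3[OF dtriangle_rotate[OF TR1_ident[OF W N]] dtriangle_rotate[OF d] m(1)
        zero_hom[OF Nobj Z]] by blast
  obtain l where l: "l \<in> homs C W X" "shift_ar C l = c" using shift_full[OF W X c] .
  have m1: "shift_ar C m \<in> homs C (shift_ob C W) (shift_ob C Y)" using shiftD(2) m by blast
  have f1: "shift_ar C f \<in> homs C (shift_ob C X) (shift_ob C Y)" using shiftD(2) tri by blast
  \<comment> \<open>Each rotation introduces one sign, so the square carries a minus on both sides
    and these cancel.\<close>
  have "neg C (shift_ar C m) = neg C (shift_ar C f \<cdot> c)"
    using sq shiftD(3)[OF W] cmp_neg_right[OF ident_hom[OF W1] m1] ident_right[OF m1]
      cmp_neg_left[OF c f1] by simp
  then have "shift_ar C m = shift_ar C f \<cdot> c" using neg_neg m1 cmp_hom[OF c f1] by metis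
  then have "shift_ar C m = shift_ar C (f \<cdot> l)" using shiftD(4)[OF l(1) tri(1)] l by simp
  then show thesis
    using that l shift_faithful[OF m(1) cmp_hom[OF l(1) tri(1)]] by metis
qed

text \<open>When \<open>f\<close> vanishes, the identity of \<open>Y\<close> satisfies the condition
  for extension along \<open>g\<close>.\<close>

lemma dtriangle_split_mono:
  assumes d: "dtriangle C X Y Z f g h" and f: "f = zero_arr C X Y"
  obtains r where "r \<in> homs C Z Y" "r \<cdot> g = ident C Y"
proof -
  have Y: "Y \<in> objs C" using homs_objs dtriangle_homs[OF d] by blast
  have "ident C Y \<cdot> f = zero_arr C X Y" using ident_left f dtriangle_homs[OF d] by metis
  then show thesis using dtriangle_extend[OF d ident_hom[OF Y]] that by metis
qed

text \<open>When \<open>g\<close> vanishes, the identity of \<open>Y\<close> lifts through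
  \<open>f\<close>.\<close>

lemma dtriangle_split_epi:
  assumes d: "dtriangle C X Y Z f g h" and g: "g = zero_arr C Y Z"
  obtains s where "s \<in> homs C Y X" "f \<cdot> s = ident C Y"
proof -
  have Y: "Y \<in> objs C" using homs_objs dtriangle_homs[OF d] by blast
  have "g \<cdot> ident C Y = zero_arr C Y Z" using ident_right g dtriangle_homs[OF d] by metis
  then show thesis using dtriangle_lift[OF d ident_hom[OF Y]] that by metis
qed

text \<open>Splitting gives a left inverse \<open>r\<close> of \<open>g\<close>. The defect
  \<open>1 - g r\<close> kills \<open>g\<close>, hence factors through \<open>h\<close> by way of a
  map \<open>X[1] \<rightarrow> Z\<close>, and all such maps are zero.\<close>

lemma dtriangle_iso_second:
  assumes d: "dtriangle C X Y Z f g h" and f: "f = zero_arr C X Y"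
    and perp: "perp C (shift_ob C X) Z"
  shows "is_iso C g"
proof -
  note tri = dtriangle_homs[OF d]
  have X: "X \<in> objs C" and Y: "Y \<in> objs C" and Z: "Z \<in> objs C" using tri homs_objs by blast+
  obtain r where r: "r \<in> homs C Z Y" "r \<cdot> g = ident C Y" using dtriangle_split_mono[OF d f] .
  have gr: "g \<cdot> r \<in> homs C Z Z" using cmp_hom r tri by blast
  let ?u = "ident C Z \<boxplus> neg C (g \<cdot> r)"
  have u: "?u \<in> homs C Z Z" using add_hom ident_hom Z neg_hom gr by blast
  have "(g \<cdot> r) \<cdot> g = g" using cmp_assoc[OF tri(2) r(1) tri(2)] r ident_right tri by simp
  then have "?u \<cdot> g = zero_arr C Y Z"
    using cmp_add_left[OF tri(2) ident_hom[OF Z] neg_hom[OF gr]] cmp_neg_left[OF tri(2) gr]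
      ident_left[OF tri(2)] add_neg[OF tri(2)] by simp
  then obtain l where l: "l \<in> homs C (shift_ob C X) Z" "l \<cdot> h = ?u"
    using dtriangle_extend[OF dtriangle_rotate[OF d] u] by metis
  then have "?u = zero_arr C Z Z"
    using perpD[OF perp l(1)] cmp_zero_left[OF tri(3) Z] by simp
  then have "g \<cdot> r = ident C Z" using eq_if_add_neg_zero ident_hom[OF Z] gr by metis
  then show ?thesis using is_isoI tri(2) r by metis
qed

text \<open>Dual argument with a right inverse \<open>s\<close> of \<open>f\<close>: the defect
  \<open>1 - s f\<close> is annihilated by \<open>f\<close>. Its shift lifts through
  \<open>h\<close> by way of a map \<open>X[1] \<rightarrow> Z\<close>, which vanishes, and
  faithfulness removes the shift.\<close>

lemma dtriangle_iso_first:
  assumes d: "dtriangle C X Y Z f g h" and g: "g = zero_arr C Y Z"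
    and perp: "perp C (shift_ob C X) Z"
  shows "is_iso C f"
proof -
  note tri = dtriangle_homs[OF d]
  have X: "X \<in> objs C" and Y: "Y \<in> objs C" and Z: "Z \<in> objs C" using tri homs_objs by blast+
  obtain s where s: "s \<in> homs C Y X" "f \<cdot> s = ident C Y" using dtriangle_split_epi[OF d g] .
  have sf: "s \<cdot> f \<in> homs C X X" using cmp_hom s tri by blast
  let ?u = "ident C X \<boxplus> neg C (s \<cdot> f)"
  have u: "?u \<in> homs C X X" using add_hom ident_hom X neg_hom sf by blast
  have "f \<cdot> (s \<cdot> f) = f" using cmp_assoc[OF tri(1) s(1) tri(1)] s ident_left tri by simp
  then have fu: "f \<cdot> ?u = zero_arr C X Y"
    using cmp_add_right[OF ident_hom[OF X] neg_hom[OF sf] tri(1)] cmp_neg_right[OF sf tri(1)]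
      ident_right[OF tri(1)] add_neg[OF tri(1)] by simp
  have f1: "shift_ar C f \<in> homs C (shift_ob C X) (shift_ob C Y)"
    and u1: "shift_ar C ?u \<in> homs C (shift_ob C X) (shift_ob C X)"
    using shiftD(2) tri u by blast+
  have "neg C (shift_ar C f) \<cdot> shift_ar C ?u = zero_arr C (shift_ob C X) (shift_ob C Y)"
    using cmp_neg_left[OF u1 f1] shiftD(4)[OF u tri(1)] fu shift_zero[OF X Y]
      neg_zero[OF shiftD(1)[OF X] shiftD(1)[OF Y]] by metis
  \<comment> \<open>After two rotations the triangle begins
    \<open>Z \<rightarrow> X[1] \<rightarrow> Y[1]\<close>, with arrows \<open>h\<close> and minus
    the shift of \<open>f\<close>; this is why the defect was shifted first.\<close>
  then obtain l where l: "l \<in> homs C (shift_ob C X) Z" "h \<cdot> l = shift_ar C ?u"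
    using dtriangle_lift[OF dtriangle_rotate[OF dtriangle_rotate[OF d]] u1] by metis
  then have "shift_ar C ?u = shift_ar C (zero_arr C X X)"
    using perpD[OF perp l(1)] cmp_zero_right[OF tri(3) shiftD(1)[OF X]] shift_zero X by simp
  then have "?u = zero_arr C X X" using shift_faithful u zero_hom X by metis
  then have "s \<cdot> f = ident C X" using eq_if_add_neg_zero ident_hom[OF X] sf by metis
  then show ?thesis using is_isoI tri(1) s by metis
qed

lemma shift_retract:
  assumes "is_retract C Y X"
  shows "is_retract C (shift_ob C Y) (shift_ob C X)"
proof -
  obtain i p where ip: "i \<in> homs C Y X" "p \<in> homs C X Y" "p \<cdot> i = ident C Y" and Y: "Y \<in> objs C"
    using assms unfolding is_retract_def by blast
  then have "shift_ar C p \<cdot> shift_ar C i = ident C (shift_ob C Y)"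
    using shiftD(3,4) by metis
  then show ?thesis using ip Y shiftD(1,2) unfolding is_retract_def by blast
qed

lemma isomorphic_sym:
  assumes "f \<in> homs C X Y" "is_iso C f"
  shows "isomorphic C Y X"
  using is_isoE[OF assms(2,1)] is_isoI assms(1) unfolding isomorphic_def by metis

section \<open>Orthogonality characterizations\<close>

lemma t_structureD:
  assumes "t_structure C t"
  shows "X \<in> le_part t \<Longrightarrow> X \<in> objs C" "X \<in> ge_part t \<Longrightarrow> X \<in> objs C"
    and "\<lbrakk>X \<in> le_part t; isomorphic C X Y\<rbrakk> \<Longrightarrow> Y \<in> le_part t"
    and "\<lbrakk>X \<in> ge_part t; isomorphic C X Y\<rbrakk> \<Longrightarrow> Y \<in> ge_part t"
    and "X \<in> le_part t \<Longrightarrow> shift_ob C X \<in> le_part t"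
    and "\<lbrakk>X \<in> le_part t; Y \<in> ge_part t\<rbrakk> \<Longrightarrow> perp C (shift_ob C X) Y"
proof -
  have "le_part t \<subseteq> objs C" "ge_part t \<subseteq> objs C" "iso_closed C (le_part t)"
    "iso_closed C (ge_part t)" "shift_ob C ` le_part t \<subseteq> le_part t"
    "orthogonal C (shift_ob C ` le_part t) (ge_part t)"
    using assms by (simp_all add: t_structure_def)
  then show "X \<in> le_part t \<Longrightarrow> X \<in> objs C" "X \<in> ge_part t \<Longrightarrow> X \<in> objs C"
    "\<lbrakk>X \<in> le_part t; isomorphic C X Y\<rbrakk> \<Longrightarrow> Y \<in> le_part t"
    "\<lbrakk>X \<in> ge_part t; isomorphic C X Y\<rbrakk> \<Longrightarrow> Y \<in> ge_part t"
    "X \<in> le_part t \<Longrightarrow> shift_ob C X \<in> le_part t"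
    "\<lbrakk>X \<in> le_part t; Y \<in> ge_part t\<rbrakk> \<Longrightarrow> perp C (shift_ob C X) Y"
    unfolding iso_closed_def orthogonal_iff_perp by blast+
qed

text \<open>The additional vanishing is what upgrades a split truncation triangle to an isomorphism.
  It is the unshifted form of \<open>A[2]\<close> being orthogonal to \<open>B\<close>, where
  \<open>A[1]\<close> still lies in \<open>le_part t\<close>.\<close>

lemma t_structure_decomp:
  assumes t: "t_structure C t" and X: "X \<in> objs C"
  obtains A B f g h where "A \<in> le_part t" "B \<in> ge_part t"
    "dtriangle C A X (unshift_ob C B) f g h" "perp C (shift_ob C A) (unshift_ob C B)"
proof -
  have "\<exists>A \<in> le_part t. \<exists>B \<in> unshift_ob C ` ge_part t. \<exists>f g h. dtriangle C A X B f g h"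
    using t X by (simp add: t_structure_def)
  then obtain A B f g h where *: "A \<in> le_part t" "B \<in> ge_part t"
    "dtriangle C A X (unshift_ob C B) f g h"
    by blast
  note t = t_structureD[OF t]
  have "perp C (shift_ob C (shift_ob C A)) B" using t(5,6) * by blast
  then have "perp C (shift_ob C A) (unshift_ob C B)"
    using perp_shift[of "shift_ob C A" "unshift_ob C B"] unshift_ob t(1,2) * shiftD(1) by simp
  then show thesis using that * by blast
qed

text \<open>The hypothesis on \<open>X[1]\<close>, unshifted, kills the truncation arrow
  \<open>X \<rightarrow> B[-1]\<close>; then \<open>A \<rightarrow> X\<close> is an isomorphism and
  closure under isomorphism applies.\<close>

lemma t_structure_le_iff:
  assumes t: "t_structure C t" and X: "X \<in> objs C"
  shows "X \<in> le_part t \<longleftrightarrow> (\<forall>Y \<in> ge_part t. perp C (shift_ob C X) Y)"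
proof
  assume perp: "\<forall>Y \<in> ge_part t. perp C (shift_ob C X) Y"
  obtain A B f g h where *: "A \<in> le_part t" "B \<in> ge_part t"
    "dtriangle C A X (unshift_ob C B) f g h" "perp C (shift_ob C A) (unshift_ob C B)"
    using t_structure_decomp[OF t X] .
  note UB = unshift_ob[OF t_structureD(2)[OF t *(2)]]
  have "perp C X (unshift_ob C B)"
    using perp *(2) perp_shift[OF X UB(1)] UB(2) by simp
  then have "is_iso C f"
    using dtriangle_iso_first[OF *(3) perpD[OF _ dtriangle_homs(2)[OF *(3)]] *(4)] by simp
  then show "X \<in> le_part t"
    using t_structureD(3)[OF t *(1)] dtriangle_homs(1)[OF *(3)] unfolding isomorphic_def by blast
qed (use t_structureD(6)[OF t] in blast)

text \<open>The object to decompose is \<open>Y[-1]\<close>: its triangle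
  \<open>A \<rightarrow> Y[-1] \<rightarrow> B[-1]\<close> has zero first arrow, so the second is an
  isomorphism, and shifting it identifies \<open>Y\<close> with \<open>B\<close>.\<close>

lemma t_structure_ge_iff:
  assumes t: "t_structure C t" and Y: "Y \<in> objs C"
  shows "Y \<in> ge_part t \<longleftrightarrow> (\<forall>X \<in> le_part t. perp C (shift_ob C X) Y)"
proof
  assume perp: "\<forall>X \<in> le_part t. perp C (shift_ob C X) Y"
  note U = unshift_ob[OF Y]
  obtain A B f g h where *: "A \<in> le_part t" "B \<in> ge_part t"
    "dtriangle C A (unshift_ob C Y) (unshift_ob C B) f g h"
    "perp C (shift_ob C A) (unshift_ob C B)"
    using t_structure_decomp[OF t U(1)] .
  note g = dtriangle_homs(2)[OF *(3)] and UB = unshift_ob[OF t_structureD(2)[OF t *(2)]]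
  have "perp C A (unshift_ob C Y)"
    using perp *(1) perp_shift[OF t_structureD(1)[OF t *(1)] U(1)] U(2) by simp
  then have "is_iso C g"
    using dtriangle_iso_second[OF *(3) perpD[OF _ dtriangle_homs(1)[OF *(3)]] *(4)] by simp
  then have "is_iso C (shift_ar C g)" "shift_ar C g \<in> homs C Y B"
    using additive_functor_iso[OF shift_functor preadditive g] shiftD(2)[OF g] U UB by auto
  then show "Y \<in> ge_part t" using isomorphic_sym t_structureD(4)[OF t *(2)] by blast
qed (use t_structureD(6)[OF t] in blast)

section \<open>Halves of a weight structure as orthogonal complements\<close>

lemma weight_structureD:
  assumes "weight_structure C w"
  shows "X \<in> le_part w \<Longrightarrow> X \<in> objs C" "X \<in> ge_part w \<Longrightarrow> X \<in> objs C"
    and "\<lbrakk>X \<in> le_part w; is_retract C Y X\<rbrakk> \<Longrightarrow> Y \<in> le_part w"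
    and "\<lbrakk>X \<in> ge_part w; is_retract C Y X\<rbrakk> \<Longrightarrow> Y \<in> ge_part w"
    and "\<lbrakk>X \<in> ge_part w; Y \<in> le_part w\<rbrakk> \<Longrightarrow> perp C X (shift_ob C Y)"
proof -
  have "le_part w \<subseteq> objs C" "ge_part w \<subseteq> objs C" "Karoubi_closed C (le_part w)"
    "Karoubi_closed C (ge_part w)" "orthogonal C (ge_part w) (shift_ob C ` le_part w)"
    using assms by (simp_all add: weight_structure_def)
  then show "X \<in> le_part w \<Longrightarrow> X \<in> objs C" "X \<in> ge_part w \<Longrightarrow> X \<in> objs C"
    "\<lbrakk>X \<in> le_part w; is_retract C Y X\<rbrakk> \<Longrightarrow> Y \<in> le_part w"
    "\<lbrakk>X \<in> ge_part w; is_retract C Y X\<rbrakk> \<Longrightarrow> Y \<in> ge_part w"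
    "\<lbrakk>X \<in> ge_part w; Y \<in> le_part w\<rbrakk> \<Longrightarrow> perp C X (shift_ob C Y)"
    unfolding Karoubi_closed_def orthogonal_iff_perp by blast+
qed

lemma weight_structure_decomp:
  assumes "weight_structure C w" and "X \<in> objs C"
  obtains A B f g h where "A \<in> le_part w" "B \<in> ge_part w" "dtriangle C (unshift_ob C B) X A f g h"
proof -
  have "\<exists>A \<in> le_part w. \<exists>B \<in> ge_part w. \<exists>f g h.
      dtriangle C (unshift_ob C B) X A f g h \<and> h \<in> homs C A B"
    using assms by (simp add: weight_structure_def)
  then show thesis using that by blast
qed

text \<open>In the triangle \<open>B[-1] \<rightarrow> X[-1] \<rightarrow> A\<close> the second
  arrow vanishes, so \<open>X[-1]\<close> is a retract of \<open>B[-1]\<close>. A retract suffices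
  because the classes are Karoubi-closed.\<close>

lemma weight_structure_ge_iff:
  assumes w: "weight_structure C w" and X: "X \<in> objs C"
  shows "X \<in> ge_part w \<longleftrightarrow> (\<forall>Y \<in> le_part w. perp C X (shift_ob C Y))"
proof
  assume perp: "\<forall>Y \<in> le_part w. perp C X (shift_ob C Y)"
  note U = unshift_ob[OF X]
  obtain A B f g h where *: "A \<in> le_part w" "B \<in> ge_part w"
    "dtriangle C (unshift_ob C B) (unshift_ob C X) A f g h"
    using weight_structure_decomp[OF w U(1)] .
  note tri = dtriangle_homs[OF *(3)] and UB = unshift_ob[OF weight_structureD(2)[OF w *(2)]]
  have "perp C (unshift_ob C X) A"
    using perp *(1) perp_shift[OF U(1) weight_structureD(1)[OF w *(1)]] U(2) by simp
  then obtain s where "s \<in> homs C (unshift_ob C X) (unshift_ob C B)"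
    "f \<cdot> s = ident C (unshift_ob C X)"
    using dtriangle_split_epi[OF *(3)] perpD tri(2) by metis
  then have "is_retract C (unshift_ob C X) (unshift_ob C B)"
    using tri(1) U(1) unfolding is_retract_def by blast
  then have "is_retract C X B" using shift_retract U(2) UB(2) by metis
  then show "X \<in> ge_part w" using weight_structureD(4)[OF w *(2)] by blast
qed (use weight_structureD(5)[OF w] in blast)

text \<open>In \<open>B[-1] \<rightarrow> Y \<rightarrow> A\<close> the first arrow vanishes, which
  makes \<open>Y\<close> a retract of \<open>A\<close>.\<close>

lemma weight_structure_le_iff:
  assumes w: "weight_structure C w" and Y: "Y \<in> objs C"
  shows "Y \<in> le_part w \<longleftrightarrow> (\<forall>X \<in> ge_part w. perp C X (shift_ob C Y))"
proof
  assume perp: "\<forall>X \<in> ge_part w. perp C X (shift_ob C Y)"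
  obtain A B f g h where *: "A \<in> le_part w" "B \<in> ge_part w"
    "dtriangle C (unshift_ob C B) Y A f g h"
    using weight_structure_decomp[OF w Y] .
  note tri = dtriangle_homs[OF *(3)] and UB = unshift_ob[OF weight_structureD(2)[OF w *(2)]]
  have "perp C (unshift_ob C B) Y"
    using perp *(2) perp_shift[OF UB(1) Y] UB(2) by simp
  then obtain r where "r \<in> homs C A Y" "r \<cdot> g = ident C Y"
    using dtriangle_split_mono[OF *(3)] perpD tri(1) by metis
  then have "is_retract C Y A" using tri(2) Y unfolding is_retract_def by blast
  then show "Y \<in> le_part w" using weight_structureD(3)[OF w *(1)] by blast
qed (use weight_structureD(5)[OF w] in blast)

end

section \<open>Exact functors and adjunctions\<close>

lemma exact_functorD:
  assumes "exact_functor C D F"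
  shows "additive_functor C D F"
    and "X \<in> objs C \<Longrightarrow> comparison F X \<in> homs D (ob F (shift_ob C X)) (shift_ob D (ob F X))"
    and "X \<in> objs C \<Longrightarrow> is_iso D (comparison F X)"
    and "f \<in> homs C X Y \<Longrightarrow> cmp D (comparison F Y) (ar F (shift_ar C f)) =
        cmp D (shift_ar D (ar F f)) (comparison F X)"
    and "dtriangle C X Y Z f g h \<Longrightarrow> dtriangle D (ob F X) (ob F Y) (ob F Z)
          (ar F f) (ar F g) (cmp D (comparison F X) (ar F h))"
  using assms unfolding exact_functor_def by blast+

text \<open>The naturality square of the composite comparison is pasted from the image under
  \<open>G\<close> of the square for \<open>F\<close> and the square for \<open>G\<close> at the
  arrow \<open>ar F f\<close>.\<close>

lemma exact_functor_comp:
  fixes C :: "('o, 'm, 'x) tricat_scheme" and D :: "('p, 'n, 'y) tricat_scheme"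
    and E :: "('q, 'k, 'z) tricat_scheme"
  assumes C: "triangulated_category C" and D: "triangulated_category D"
    and E: "triangulated_category E"
    and F: "exact_functor C D F" and G: "exact_functor D E G"
  shows "exact_functor C E (exfun_comp E G F)"
proof -
  interpret C: triangulated_category C by fact
  interpret D: triangulated_category D by fact
  interpret E: triangulated_category E by fact
  note F = exact_functorD[OF F] and G = exact_functorD[OF G]
  note Fa = additive_functorD[OF F(1)] and Ga = additive_functorD[OF G(1)]
  note homs = Fa(1,2) Ga(1,2) C.shiftD(1,2) D.shiftD(1,2) E.shiftD(1,2) F(2) G(2)
  have [simp]: "ob (exfun_comp E G F) X = ob G (ob F X)"
    "ar (exfun_comp E G F) f = ar G (ar F f)"
    "comparison (exfun_comp E G F) X = cmp E (comparison G (ob F X)) (ar G (comparison F X))"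
    for X f by (simp_all add: exfun_comp_def)
  show ?thesis unfolding exact_functor_def
  proof (intro conjI allI ballI impI)
    show "additive_functor C E (exfun_comp E G F)"
      unfolding additive_functor_def using Fa(1,2) Ga(1,2)
      by (auto simp: Fa(3) Ga(3) Fa(4) Ga(4)[OF Fa(2) Fa(2)] Fa(5) Ga(5)[OF Fa(2) Fa(2)])
  next
    fix X assume X: "X \<in> objs C"
    have c: "comparison F X \<in> homs D (ob F (shift_ob C X)) (shift_ob D (ob F X))"
      using F(2) X .
    have a: "ar G (comparison F X) \<in> homs E (ob G (ob F (shift_ob C X))) (ob G (shift_ob D (ob F X)))"
      and b: "comparison G (ob F X) \<in> homs E (ob G (shift_ob D (ob F X))) (shift_ob E (ob G (ob F X)))"
      using Ga(2)[OF c] G(2)[OF Fa(1)[OF X]] by auto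
    show "comparison (exfun_comp E G F) X
        \<in> homs E (ob (exfun_comp E G F) (shift_ob C X)) (shift_ob E (ob (exfun_comp E G F) X))"
      using E.cmp_hom[OF a b] by simp
    show "is_iso E (comparison (exfun_comp E G F) X)"
      using E.is_iso_cmp[OF a additive_functor_iso[OF G(1) D.preadditive c F(3)[OF X]] b
          G(3)[OF Fa(1)[OF X]]] by simp
  next
    fix X Y f assume f: "f \<in> homs C X Y"
    have X: "X \<in> objs C" and Y: "Y \<in> objs C" using f C.homs_objs by blast+
    let ?X1 = "ob G (ob F (shift_ob C X))" and ?Y1 = "ob G (ob F (shift_ob C Y))"
      and ?X2 = "ob G (shift_ob D (ob F X))" and ?Y2 = "ob G (shift_ob D (ob F Y))"
      and ?X3 = "shift_ob E (ob G (ob F X))" and ?Y3 = "shift_ob E (ob G (ob F Y))"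
    have *: "ar G (ar F (shift_ar C f)) \<in> homs E ?X1 ?Y1"
        "ar G (shift_ar D (ar F f)) \<in> homs E ?X2 ?Y2"
        "shift_ar E (ar G (ar F f)) \<in> homs E ?X3 ?Y3"
        "ar G (comparison F X) \<in> homs E ?X1 ?X2" "ar G (comparison F Y) \<in> homs E ?Y1 ?Y2"
        "comparison G (ob F X) \<in> homs E ?X2 ?X3" "comparison G (ob F Y) \<in> homs E ?Y2 ?Y3"
      using f X Y homs by auto
    have "ar G (cmp D (comparison F Y) (ar F (shift_ar C f)))
        = ar G (cmp D (shift_ar D (ar F f)) (comparison F X))" using F(4)[OF f] by simp
    then have sq: "cmp E (ar G (comparison F Y)) (ar G (ar F (shift_ar C f)))
        = cmp E (ar G (shift_ar D (ar F f))) (ar G (comparison F X))"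
      using Ga(4)[OF Fa(2)[OF C.shiftD(2)[OF f]] F(2)[OF Y]]
        Ga(4)[OF F(2)[OF X] D.shiftD(2)[OF Fa(2)[OF f]]] by simp
    show "cmp E (comparison (exfun_comp E G F) Y) (ar (exfun_comp E G F) (shift_ar C f)) =
        cmp E (shift_ar E (ar (exfun_comp E G F) f)) (comparison (exfun_comp E G F) X)"
      using E.cmp_assoc[OF *(1,5,7)] sq E.cmp_assoc[OF *(4,2,7)] G(4)[OF Fa(2)[OF f]]
        E.cmp_assoc[OF *(4,6,3)] by simp
  next
    fix X Y Z f g h assume d: "dtriangle C X Y Z f g h"
    have h: "h \<in> homs C Z (shift_ob C X)" and X: "X \<in> objs C"
      using C.dtriangle_homs[OF d] C.homs_objs by blast+
    note c = F(2)[OF X]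
    show "dtriangle E (ob (exfun_comp E G F) X) (ob (exfun_comp E G F) Y) (ob (exfun_comp E G F) Z)
        (ar (exfun_comp E G F) f) (ar (exfun_comp E G F) g)
        (cmp E (comparison (exfun_comp E G F) X) (ar (exfun_comp E G F) h))"
      \<comment> \<open>Applying \<open>G\<close> after \<open>F\<close> to the triangle gives the
        right third arrow up to functoriality of \<open>G\<close> on \<open>comparison F X\<close>
        composed with \<open>ar F h\<close>, and reassociation.\<close>
      using G(5)[OF F(5)[OF d]] Ga(4)[OF Fa(2)[OF h] c]
        E.cmp_assoc[OF Ga(2)[OF Fa(2)[OF h]] Ga(2)[OF c] G(2)[OF Fa(1)[OF X]]] by simp
  qed
qed

text \<open>Named by the side of the adjunction instead of by \<open>F\<close> and \<open>G\<close>,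
  since the two claims about adjoints assign these roles in opposite ways.\<close>

locale exact_adjunction =
  A: triangulated_category A + B: triangulated_category B
  for A :: "('o, 'm, 'x) tricat_scheme" and B :: "('p, 'n, 'y) tricat_scheme" +
  fixes L :: "('o, 'm, 'p, 'n) exfun" and R :: "('p, 'n, 'o, 'm) exfun"
  assumes L: "exact_functor A B L" and R: "exact_functor B A R"
    and adjoint: "left_adjoint_to A B L R"
begin

lemma L_obj: "X \<in> objs A \<Longrightarrow> ob L X \<in> objs B"
  and R_obj: "Y \<in> objs B \<Longrightarrow> ob R Y \<in> objs A"
  using additive_functorD(1)[OF exact_functorD(1)[OF L]]
    additive_functorD(1)[OF exact_functorD(1)[OF R]] by auto

lemma perp_adjoint:
  assumes "X \<in> objs A" "Y \<in> objs B"
  shows "perp B (ob L X) Y \<longleftrightarrow> perp A X (ob R Y)"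
proof -
  obtain \<phi> where "bij_betw \<phi> (homs B (ob L X) Y) (homs A X (ob R Y))"
    using adjoint assms unfolding left_adjoint_to_def by blast
  \<comment> \<open>Equal cardinality is enough: a singleton is a set with \<open>card\<close> equal
    to 1, while infinite hom sets get the default value 0 and cannot be mistaken for one.\<close>
  then have "card (homs B (ob L X) Y) = card (homs A X (ob R Y))" by (rule bij_betw_same_card)
  then show ?thesis
    using A.perp_iff_singleton B.perp_iff_singleton assms L_obj R_obj
    by (simp add: is_singleton_altdef)
qed

text \<open>The comparison isomorphism of \<open>L\<close> replaces \<open>L(X)[1]\<close> by
  \<open>L(X[1])\<close>, to which the adjunction applies.\<close>

lemma perp_shift_source:
  assumes X: "X \<in> objs A" and Y: "Y \<in> objs B"
  shows "perp B (shift_ob B (ob L X)) Y \<longleftrightarrow> perp A (shift_ob A X) (ob R Y)"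
  using B.perp_iso_left[OF exact_functorD(2,3)[OF L X] Y] perp_adjoint[OF A.shiftD(1)[OF X] Y]
  by simp

text \<open>Here the adjunction comes first and the comparison isomorphism of \<open>R\<close> turns
  \<open>R(Y[1])\<close> into \<open>R(Y)[1]\<close>.\<close>

lemma perp_shift_target:
  assumes X: "X \<in> objs A" and Y: "Y \<in> objs B"
  shows "perp B (ob L X) (shift_ob B Y) \<longleftrightarrow> perp A X (shift_ob A (ob R Y))"
  using A.perp_iso_right[OF exact_functorD(2,3)[OF R Y] X] perp_adjoint[OF X B.shiftD(1)[OF Y]]
  by simp

text \<open>Through the orthogonality characterizations both inclusions become the same family of
  vanishing conditions, indexed by pairs from \<open>le_part a\<close> and
  \<open>ge_part b\<close>.\<close>

lemma t_structure_image_iff: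
  assumes a: "t_structure A a" and b: "t_structure B b"
  shows "ob L ` le_part a \<subseteq> le_part b \<longleftrightarrow> ob R ` ge_part b \<subseteq> ge_part a"
proof -
  note D = A.t_structureD(1,2)[OF a] B.t_structureD(1,2)[OF b]
  have "ob L ` le_part a \<subseteq> le_part b \<longleftrightarrow>
      (\<forall>X \<in> le_part a. \<forall>Y \<in> ge_part b. perp B (shift_ob B (ob L X)) Y)"
    using B.t_structure_le_iff[OF b L_obj] D by blast
  also have "\<dots> \<longleftrightarrow> (\<forall>Y \<in> ge_part b. \<forall>X \<in> le_part a. perp A (shift_ob A X) (ob R Y))"
    using perp_shift_source D by blast
  also have "\<dots> \<longleftrightarrow> ob R ` ge_part b \<subseteq> ge_part a"
    using A.t_structure_ge_iff[OF a R_obj] D by blast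
  finally show ?thesis .
qed

text \<open>As for t-structures, but orthogonality now runs from the \<open>ge\<close> half to the
  shifted \<open>le\<close> half, so the halves respected by \<open>L\<close> and by
  \<open>R\<close> are exchanged.\<close>

lemma weight_structure_image_iff:
  assumes a: "weight_structure A a" and b: "weight_structure B b"
  shows "ob L ` ge_part a \<subseteq> ge_part b \<longleftrightarrow> ob R ` le_part b \<subseteq> le_part a"
proof -
  note D = A.weight_structureD(1,2)[OF a] B.weight_structureD(1,2)[OF b]
  have "ob L ` ge_part a \<subseteq> ge_part b \<longleftrightarrow>
      (\<forall>X \<in> ge_part a. \<forall>Y \<in> le_part b. perp B (ob L X) (shift_ob B Y))"
    using B.weight_structure_ge_iff[OF b L_obj] D by blast
  also have "\<dots> \<longleftrightarrow> (\<forall>Y \<in> le_part b. \<forall>X \<in> ge_part a. perp A X (shift_ob A (ob R Y)))"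
    using perp_shift_target D by blast
  also have "\<dots> \<longleftrightarrow> ob R ` le_part b \<subseteq> le_part a"
    using A.weight_structure_le_iff[OF a R_obj] D by blast
  finally show ?thesis .
qed

text \<open>For \<open>L\<close>, the \<open>le\<close> condition is one on t-structures by
  adjacency and becomes the \<open>ge\<close> condition for \<open>R\<close>; the \<open>ge\<close>
  condition becomes, through the weight structures, the \<open>le\<close> condition for
  \<open>R\<close>, where adjacency applies again.\<close>

lemma weight_exact_left_iff_t_exact_right:
  assumes "t_structure A ta" "t_structure B tb" "weight_structure A wa" "weight_structure B wb"
    and "left_adjacent wa ta" "left_adjacent wb tb"
  shows "weight_exact A wa B wb L \<longleftrightarrow> t_exact B tb A ta R"
  using t_structure_image_iff[OF assms(1,2)] weight_structure_image_iff[OF assms(3,4)]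
    assms(5,6) L R
  by (auto simp only: weight_exact_def t_exact_def left_adjacent_def)

text \<open>Now the \<open>ge\<close> halves are shared: the \<open>ge\<close> condition for
  \<open>R\<close> passes through the t-structures to the \<open>le\<close> condition for
  \<open>L\<close>, and the \<open>le\<close> condition for \<open>R\<close> through the weight
  structures to the \<open>ge\<close> condition for \<open>L\<close>.\<close>

lemma weight_exact_right_iff_t_exact_left:
  assumes "t_structure A ta" "t_structure B tb" "weight_structure A wa" "weight_structure B wb"
    and "right_adjacent wa ta" "right_adjacent wb tb"
  shows "weight_exact B wb A wa R \<longleftrightarrow> t_exact A ta B tb L"
  using t_structure_image_iff[OF assms(1,2)] weight_structure_image_iff[OF assms(3,4)]
    assms(5,6) L R
  by (auto simp only: weight_exact_def t_exact_def right_adjacent_def)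

end

section \<open>Composites of t-exact and weight-exact functors, and the combined statement\<close>

lemma t_exact_comp:
  assumes "triangulated_category C" "triangulated_category C'" "triangulated_category C''"
    and "t_exact C t C' t' F" "t_exact C' t' C'' t'' G"
  shows "t_exact C t C'' t'' (exfun_comp C'' G F)"
proof -
  have "exact_functor C C' F" "exact_functor C' C'' G"
    using assms(4,5) by (simp_all add: t_exact_def)
  then have "exact_functor C C'' (exfun_comp C'' G F)"
    by (rule exact_functor_comp[OF assms(1-3)])
  moreover have "ob (exfun_comp C'' G F) X = ob G (ob F X)" for X
    by (simp add: exfun_comp_def)
  ultimately show ?thesis using assms(4,5) by (simp add: t_exact_def image_subset_iff)
qed

lemma weight_exact_comp:
  assumes "triangulated_category C" "triangulated_category C'" "triangulated_category C''"
    and "weight_exact C w C' w' F" "weight_exact C' w' C'' w'' G"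
  shows "weight_exact C w C'' w'' (exfun_comp C'' G F)"
proof -
  have "exact_functor C C' F" "exact_functor C' C'' G"
    using assms(4,5) by (simp_all add: weight_exact_def)
  then have "exact_functor C C'' (exfun_comp C'' G F)"
    by (rule exact_functor_comp[OF assms(1-3)])
  moreover have "ob (exfun_comp C'' G F) X = ob G (ob F X)" for X
    by (simp add: exfun_comp_def)
  ultimately show ?thesis using assms(4,5) by (simp add: weight_exact_def image_subset_iff)
qed

theorem proposition4p4p5:
  "(\<forall>(C :: ('o1, 'm1) tricat) (C' :: ('o2, 'm2) tricat) (C'' :: ('o3, 'm3) tricat) t t' t'' F G.
      triangulated_category C \<and> triangulated_category C' \<and> triangulated_category C'' \<and>
      t_structure C t \<and> t_structure C' t' \<and> t_structure C'' t'' \<and>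
      t_exact C t C' t' F \<and> t_exact C' t' C'' t'' G \<longrightarrow>
      t_exact C t C'' t'' (exfun_comp C'' G F)) \<and>
   (\<forall>(C :: ('o1, 'm1) tricat) (C' :: ('o2, 'm2) tricat) (C'' :: ('o3, 'm3) tricat) w w' w'' F G.
      triangulated_category C \<and> triangulated_category C' \<and> triangulated_category C'' \<and>
      weight_structure C w \<and> weight_structure C' w' \<and> weight_structure C'' w'' \<and>
      weight_exact C w C' w' F \<and> weight_exact C' w' C'' w'' G \<longrightarrow>
      weight_exact C w C'' w'' (exfun_comp C'' G F)) \<and>
   (\<forall>(C :: ('o1, 'm1) tricat) (C' :: ('o2, 'm2) tricat) t t' w w' F G.
      triangulated_category C \<and> triangulated_category C' \<and>
      t_structure C t \<and> t_structure C' t' \<and> weight_structure C w \<and> weight_structure C' w' \<and>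
      exact_functor C C' F \<and> exact_functor C' C G \<and>
      left_adjacent w t \<and> left_adjacent w' t' \<and> left_adjoint_to C' C G F \<longrightarrow>
      (weight_exact C' w' C w G \<longleftrightarrow> t_exact C t C' t' F)) \<and>
   (\<forall>(C :: ('o1, 'm1) tricat) (C' :: ('o2, 'm2) tricat) t t' w w' F G.
      triangulated_category C \<and> triangulated_category C' \<and>
      t_structure C t \<and> t_structure C' t' \<and> weight_structure C w \<and> weight_structure C' w' \<and>
      exact_functor C C' F \<and> exact_functor C' C G \<and>
      right_adjacent w t \<and> right_adjacent w' t' \<and> left_adjoint_to C C' F G \<longrightarrow>
      (weight_exact C' w' C w G \<longleftrightarrow> t_exact C t C' t' F))"
proof (intro conjI allI impI; elim conjE)
  show "weight_exact C' w' C w G \<longleftrightarrow> t_exact C t C' t' F"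
    if "triangulated_category C" "triangulated_category C'"
      "t_structure C t" "t_structure C' t'" "weight_structure C w" "weight_structure C' w'"
      "exact_functor C C' F" "exact_functor C' C G"
      "left_adjacent w t" "left_adjacent w' t'" "left_adjoint_to C' C G F"
    for C :: "('o1, 'm1) tricat" and C' :: "('o2, 'm2) tricat" and t t' w w' F G
  proof -
    \<comment> \<open>The left adjoint is \<open>G\<close>, so the category called \<open>A\<close>
      in the locale is \<open>C'\<close>.\<close>
    interpret exact_adjunction C' C G F
      using that by (simp add: exact_adjunction_def exact_adjunction_axioms_def)
    show ?thesis using that by (intro weight_exact_left_iff_t_exact_right)
  qed
  show "weight_exact C' w' C w G \<longleftrightarrow> t_exact C t C' t' F"
    if "triangulated_category C" "triangulated_category C'"
      "t_structure C t" "t_structure C' t'" "weight_structure C w" "weight_structure C' w'"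
      "exact_functor C C' F" "exact_functor C' C G"
      "right_adjacent w t" "right_adjacent w' t'" "left_adjoint_to C C' F G"
    for C :: "('o1, 'm1) tricat" and C' :: "('o2, 'm2) tricat" and t t' w w' F G
  proof -
    \<comment> \<open>That \<open>G\<close> is right adjoint to \<open>F\<close> makes
      \<open>F\<close> the left adjoint, so \<open>A\<close> is now \<open>C\<close>.\<close>
    interpret exact_adjunction C C' F G
      using that by (simp add: exact_adjunction_def exact_adjunction_axioms_def)
    show ?thesis using that by (intro weight_exact_right_iff_t_exact_left)
  qed
qed (blast intro: t_exact_comp weight_exact_comp)+

end
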